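(* Let $\mathfrak{R}$ be an expansion of $(\mathbb{R},<,+)$ that does not define $\mathcal{B}$. Then every nowhere dense $\mathfrak{R}$-definable subset of $\mathbb{R}$ is Lebesgue null.
   Context: $\mathcal{B}$ denotes the two-sorted first order structure $(\mathcal{P}(\mathbb{N}),\mathbb{N},\in,+1)$, where $\mathcal{P}(\mathbb{N})$ is the power set of $\mathbb{N}$, $\in$ is the membership relation between $\mathbb{N}$ and $\mathcal{P}(\mathbb{N})$, and $+1$ is the successor function on $\mathbb{N}$. "Definable" means first order definable with parameters. A structure with underlying set $\mathbb{R}$ "defines $\mathcal{B}$" if it defines an isomorphic copy of $\mathcal{B}$: there are definable sets $N', P'$ (subsets of Cartesian powers of $\mathbb{R}$), a definable relation $\epsilon \subseteq N' \times P'$ and a definable function $s: N' \to N'$ such that the two-sorted structure $(P',N',\epsilon,s)$ is isomorphic to $\mathcal{B}$. *)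

theory Defs
  imports "HOL-Analysis.Analysis"
begin

text \<open>
  A structure has the whole type \<open>'a\<close> as its underlying set. Its language has the elements of
  \<open>'f\<close> as function symbols (constants have arity \<open>0\<close>) and the elements of \<open>'r\<close> as relation symbols.
  Interpretations take argument lists; only lists whose length is the arity of the symbol matter.
\<close>

record ('a, 'f, 'r) fo_structure =
  fun_arity :: "'f \<Rightarrow> nat"
  rel_arity :: "'r \<Rightarrow> nat"
  fun_interp :: "'f \<Rightarrow> 'a list \<Rightarrow> 'a"
  rel_interp :: "'r \<Rightarrow> 'a list \<Rightarrow> bool"

text \<open>
  Variables are de Bruijn indices: \<open>Ex\<close> binds index \<open>0\<close> and shifts the others by one.
\<close>

datatype 'f fo_term = Var nat | Fun 'f "'f fo_term list"

datatype ('f, 'r) fo_formula =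
    Eq "'f fo_term" "'f fo_term"
  | Rel 'r "'f fo_term list"
  | Neg "('f, 'r) fo_formula"
  | Conj "('f, 'r) fo_formula" "('f, 'r) fo_formula"
  | Ex "('f, 'r) fo_formula"

primrec wf_term :: "('a, 'f, 'r) fo_structure \<Rightarrow> 'f fo_term \<Rightarrow> bool" where
  "wf_term S (Var i) \<longleftrightarrow> True"
| "wf_term S (Fun f ts) \<longleftrightarrow> length ts = fun_arity S f \<and> list_all (wf_term S) ts"

primrec wf_formula :: "('a, 'f, 'r) fo_structure \<Rightarrow> ('f, 'r) fo_formula \<Rightarrow> bool" where
  "wf_formula S (Eq t u) \<longleftrightarrow> wf_term S t \<and> wf_term S u"
| "wf_formula S (Rel r ts) \<longleftrightarrow> length ts = rel_arity S r \<and> list_all (wf_term S) ts"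
| "wf_formula S (Neg \<phi>) \<longleftrightarrow> wf_formula S \<phi>"
| "wf_formula S (Conj \<phi> \<psi>) \<longleftrightarrow> wf_formula S \<phi> \<and> wf_formula S \<psi>"
| "wf_formula S (Ex \<phi>) \<longleftrightarrow> wf_formula S \<phi>"

primrec eval_term :: "('a, 'f, 'r) fo_structure \<Rightarrow> (nat \<Rightarrow> 'a) \<Rightarrow> 'f fo_term \<Rightarrow> 'a" where
  "eval_term S e (Var i) = e i"
| "eval_term S e (Fun f ts) = fun_interp S f (map (eval_term S e) ts)"

primrec sat :: "('a, 'f, 'r) fo_structure \<Rightarrow> (nat \<Rightarrow> 'a) \<Rightarrow> ('f, 'r) fo_formula \<Rightarrow> bool" where
  "sat S e (Eq t u) \<longleftrightarrow> eval_term S e t = eval_term S e u"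
| "sat S e (Rel r ts) \<longleftrightarrow> rel_interp S r (map (eval_term S e) ts)"
| "sat S e (Neg \<phi>) \<longleftrightarrow> \<not> sat S e \<phi>"
| "sat S e (Conj \<phi> \<psi>) \<longleftrightarrow> sat S e \<phi> \<and> sat S e \<psi>"
| "sat S e (Ex \<phi>) \<longleftrightarrow> (\<exists>x. sat S (case_nat x e) \<phi>)"

text \<open>
  The \<open>n\<close>-th Cartesian power of the underlying set is the set of lists of length \<open>n\<close>. The free
  variables \<open>0, \<dots>, n - 1\<close> stand for the coordinates of a point \<open>xs\<close>; the remaining ones stand for
  parameters \<open>p 0, p 1, \<dots>\<close>, of which a formula mentions only finitely many.
\<close>

definition point_env :: "'a list \<Rightarrow> (nat \<Rightarrow> 'a) \<Rightarrow> nat \<Rightarrow> 'a" where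
  "point_env xs p i = (if i < length xs then xs ! i else p (i - length xs))"

definition definable :: "('a, 'f, 'r) fo_structure \<Rightarrow> nat \<Rightarrow> 'a list set \<Rightarrow> bool" where
  "definable S n X \<longleftrightarrow>
     (\<exists>\<phi> p. wf_formula S \<phi> \<and> X = {xs. length xs = n \<and> sat S (point_env xs p) \<phi>})"

definition definable_subset :: "('a, 'f, 'r) fo_structure \<Rightarrow> 'a set \<Rightarrow> bool" where
  "definable_subset S A \<longleftrightarrow> definable S 1 {[x] | x. x \<in> A}"

definition expands_ordered_group_real :: "(real, 'f, 'r) fo_structure \<Rightarrow> bool" where
  "expands_ordered_group_real S \<longleftrightarrow>
     (\<exists>less. rel_arity S less = 2 \<and> (\<forall>x y. rel_interp S less [x, y] \<longleftrightarrow> x < y)) \<and>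
     (\<exists>plus. fun_arity S plus = 2 \<and> (\<forall>x y. fun_interp S plus [x, y] = x + y))"

record ('p, 'n) two_sorted =
  set_sort :: "'p set"
  num_sort :: "'n set"
  mem_rel :: "('n \<times> 'p) set"
  succ_fun :: "'n \<Rightarrow> 'n"

definition structure_B :: "(nat set, nat) two_sorted" where
  "structure_B = \<lparr>set_sort = UNIV, num_sort = UNIV, mem_rel = {(n, X). n \<in> X}, succ_fun = Suc\<rparr>"

definition two_sorted_isomorphic :: "('p, 'n) two_sorted \<Rightarrow> ('q, 'm) two_sorted \<Rightarrow> bool" where
  "two_sorted_isomorphic M M' \<longleftrightarrow>
     (\<exists>g h. bij_betw g (set_sort M) (set_sort M') \<and> bij_betw h (num_sort M) (num_sort M') \<and>
        (\<forall>x\<in>num_sort M. \<forall>y\<in>set_sort M. (x, y) \<in> mem_rel M \<longleftrightarrow> (h x, g y) \<in> mem_rel M') \<and>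
        (\<forall>x\<in>num_sort M. h (succ_fun M x) = succ_fun M' (h x)))"

text \<open>
  The two sorts live in Cartesian powers \<open>k\<close> and \<open>l\<close>; a relation between them is regarded as a
  subset of the power \<open>k + l\<close> by concatenation, and a function is definable if its graph is.
\<close>

definition definable_two_sorted ::
  "('a, 'f, 'r) fo_structure \<Rightarrow> ('a list, 'a list) two_sorted \<Rightarrow> bool" where
  "definable_two_sorted S M \<longleftrightarrow>
     (\<exists>k l. definable S k (num_sort M) \<and> definable S l (set_sort M) \<and>
        mem_rel M \<subseteq> num_sort M \<times> set_sort M \<and>
        definable S (k + l) {xs @ ys | xs ys. (xs, ys) \<in> mem_rel M} \<and>
        succ_fun M ` num_sort M \<subseteq> num_sort M \<and>
        definable S (k + k) {xs @ succ_fun M xs | xs. xs \<in> num_sort M})"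

definition defines_B :: "('a, 'f, 'r) fo_structure \<Rightarrow> bool" where
  "defines_B S \<longleftrightarrow> (\<exists>M. definable_two_sorted S M \<and> two_sorted_isomorphic M structure_B)"

definition nowhere_dense :: "'a::topological_space set \<Rightarrow> bool" where
  "nowhere_dense A \<longleftrightarrow> interior (closure A) = {}"

end

theory Submission
  imports Defs
begin

text \<open>
  Suppose that \<open>A\<close> is not null. Then the part \<open>K\<close> of \<open>closure
  A\<close> in some interval \<open>[-m, m]\<close> is definable, compact, nowhere dense and of
  positive measure; a copy of the structure \<open>(P(N), N, \<in>, +1)\<close> can be defined
  from it.

  \<^bold>\<open>A dense set filtered by finite sets.\<close> Let \<open>E \<delta>\<close> be the
  set of those points of \<open>K\<close> that are followed by a gap of \<open>K\<close> of length
  at least \<open>\<delta>\<close>. It is finite because \<open>K\<close> is bounded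
  (\<open>finite_gap_starts\<close>), and the union of these sets is dense in \<open>K\<close>
  because \<open>K\<close> is nowhere dense (\<open>ex_gap_start_near\<close>). By Steinhaus'
  theorem (\<open>ex_differences_near_zero\<close>), which is where positive measure is used, the
  differences of points of \<open>K\<close> cover an interval \<open>(0, \<eta>)\<close>. So the
  finite sets \<open>G \<delta>\<close> of differences of points of \<open>E \<delta>\<close> that
  lie in \<open>(0, \<eta>)\<close> grow as \<open>\<delta>\<close> decreases to \<open>0\<close>,
  and their union is dense in \<open>(0, \<eta>)\<close>. This is the situation of the locale
  \<open>finite_refinement\<close>, and the rest of the argument uses only this and the
  definability of \<open>G\<close>.

  \<^bold>\<open>The numbers.\<close> For a real \<open>c\<close>, call \<open>p < c\<close> a
  record if for some \<open>\<delta>\<close> it is the last point of \<open>G \<delta>\<close>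
  below \<open>c\<close>. Since the union of the \<open>G \<delta>\<close> is dense,
  \<open>c\<close> can be found as the limit of records \<open>n 0 < n 1 < \<dots>\<close> whose
  differences \<open>d i = n (i + 1) - n i\<close> decrease as fast as desired
  (\<open>ex_fast_records\<close>). All records beyond a certain point belong to this sequence, so
  its range is definable from \<open>c\<close>, and the successor is definable from the order of
  the reals.

  \<^bold>\<open>The sets.\<close> A real \<open>x\<close> stands for the set of those
  \<open>i\<close> for which \<open>x\<close> lies in the first third of an interval between
  consecutive points of \<open>G (d i)\<close>; for the other \<open>i\<close> it has to lie in
  the fourth sixth of such an interval. As \<open>d (i + 1)\<close> is so small that \<open>G (d
  (i + 1))\<close> has two points in each of these pieces, all choices can be made independently,
  and every set of natural numbers is coded by a point of some nested sequence of intervals. The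
  codes of a given set form a compact set, whose least element is a definable choice of a unique
  code (\<open>ex_least_code\<close>). Uniqueness matters because the sorts of the copy are sets
  of tuples with true equality, not quotients.
\<close>

section \<open>Predicates definable with parameters\<close>

primrec rename_term :: "(nat \<Rightarrow> nat) \<Rightarrow> 'f fo_term \<Rightarrow> 'f fo_term" where
  "rename_term \<rho> (Var i) = Var (\<rho> i)"
| "rename_term \<rho> (Fun f ts) = Fun f (map (rename_term \<rho>) ts)"

primrec rename :: "(nat \<Rightarrow> nat) \<Rightarrow> ('f, 'r) fo_formula \<Rightarrow> ('f, 'r) fo_formula" where
  "rename \<rho> (Eq t u) = Eq (rename_term \<rho> t) (rename_term \<rho> u)"
| "rename \<rho> (Rel r ts) = Rel r (map (rename_term \<rho>) ts)"
| "rename \<rho> (Neg \<phi>) = Neg (rename \<rho> \<phi>)"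
| "rename \<rho> (Conj \<phi> \<psi>) = Conj (rename \<rho> \<phi>) (rename \<rho> \<psi>)"
| "rename \<rho> (Ex \<phi>) = Ex (rename (case_nat 0 (\<lambda>i. Suc (\<rho> i))) \<phi>)"

lemma wf_rename_term [simp]: "wf_term S (rename_term \<rho> t) \<longleftrightarrow> wf_term S t"
  by (induction t) (auto simp: list_all_iff)

lemma eval_rename_term [simp]: "eval_term S e (rename_term \<rho> t) = eval_term S (\<lambda>i. e (\<rho> i)) t"
  by (induction t) (simp_all add: comp_def cong: map_cong)

lemma wf_rename [simp]: "wf_formula S (rename \<rho> \<phi>) \<longleftrightarrow> wf_formula S \<phi>"
  by (induction \<phi> arbitrary: \<rho>) (auto simp: list_all_iff)

lemma sat_rename [simp]: "sat S e (rename \<rho> \<phi>) \<longleftrightarrow> sat S (\<lambda>i. e (\<rho> i)) \<phi>"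
proof (induction \<phi> arbitrary: \<rho> e)
  case (Ex \<phi>)
  have "(\<lambda>i. case_nat x e (case_nat 0 (\<lambda>i. Suc (\<rho> i)) i)) = case_nat x (\<lambda>i. e (\<rho> i))" for x
    by (auto split: nat.splits)
  then show ?case
    by (simp add: Ex)
qed (simp_all add: comp_def)

text \<open>
  The slots of a formula are its free variables; each is filled by a variable of the predicate or
  by a parameter. Leaving the position of the parameters free makes it harmless to combine
  formulas with different parameters.
\<close>

definition slot_env :: "(nat \<Rightarrow> nat + 'a) \<Rightarrow> (nat \<Rightarrow> 'a) \<Rightarrow> nat \<Rightarrow> 'a" where
  "slot_env m e i = (case m i of Inl j \<Rightarrow> e j | Inr a \<Rightarrow> a)"

definition definable_pred :: "('a, 'f, 'r) fo_structure \<Rightarrow> ((nat \<Rightarrow> 'a) \<Rightarrow> bool) \<Rightarrow> bool" where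
  "definable_pred S P \<longleftrightarrow> (\<exists>\<phi> m. wf_formula S \<phi> \<and> (\<forall>e. P e \<longleftrightarrow> sat S (slot_env m e) \<phi>))"

definition definable_term :: "('a, 'f, 'r) fo_structure \<Rightarrow> ((nat \<Rightarrow> 'a) \<Rightarrow> 'a) \<Rightarrow> bool" where
  "definable_term S t \<longleftrightarrow> (\<exists>\<tau> m. wf_term S \<tau> \<and> (\<forall>e. t e = eval_term S (slot_env m e) \<tau>))"

text \<open>
  Two formulas are put over disjoint slots, the even and the odd ones, so that their variables and
  parameters do not interfere.
\<close>

definition interleave :: "(nat \<Rightarrow> 'b) \<Rightarrow> (nat \<Rightarrow> 'b) \<Rightarrow> nat \<Rightarrow> 'b" where
  "interleave m m' i = (if even i then m (i div 2) else m' (i div 2))"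

lemma slot_env_interleave:
  "(\<lambda>i. slot_env (interleave m m') e (2 * i)) = slot_env m e"
  "(\<lambda>i. slot_env (interleave m m') e (Suc (2 * i))) = slot_env m' e"
  by (auto simp: slot_env_def interleave_def)

lemma definable_predI:
  assumes "wf_formula S \<phi>" "\<And>e. P e \<longleftrightarrow> sat S (slot_env m e) \<phi>"
  shows "definable_pred S P"
  using assms unfolding definable_pred_def by blast

lemma definable_predE:
  assumes "definable_pred S P"
  obtains \<phi> m where "wf_formula S \<phi>" "\<And>e. P e \<longleftrightarrow> sat S (slot_env m e) \<phi>"
  using assms unfolding definable_pred_def by blast

lemma definable_pred_neg:
  "definable_pred S P \<Longrightarrow> definable_pred S (\<lambda>e. \<not> P e)"
  by (erule definable_predE, rule definable_predI[where \<phi> = "Neg _"]) auto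

lemma definable_pred_conj:
  assumes "definable_pred S P" "definable_pred S Q"
  shows "definable_pred S (\<lambda>e. P e \<and> Q e)"
proof -
  obtain \<phi> m where \<phi>: "wf_formula S \<phi>" "\<And>e. P e \<longleftrightarrow> sat S (slot_env m e) \<phi>"
    by (rule definable_predE[OF assms(1)]) blast
  obtain \<psi> m' where \<psi>: "wf_formula S \<psi>" "\<And>e. Q e \<longleftrightarrow> sat S (slot_env m' e) \<psi>"
    by (rule definable_predE[OF assms(2)]) blast
  show ?thesis
    by (rule definable_predI[where m = "interleave m m'" and
          \<phi> = "Conj (rename (\<lambda>i. 2 * i) \<phi>) (rename (\<lambda>i. Suc (2 * i)) \<psi>)"])
      (simp_all add: \<phi> \<psi> slot_env_interleave)
qed

text \<open>
  The predicate under the quantifier is an arbitrary function of the bound value and the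
  environment. Used backwards, the rule turns \<open>x\<close> into variable \<open>0\<close> and
  every \<open>e i\<close> into \<open>e (Suc i)\<close> by higher-order pattern unification, so
  definability of a formula is proved by following its syntax.
\<close>

lemma definable_pred_ex:
  assumes "definable_pred S (\<lambda>e. P (e 0) (\<lambda>i. e (Suc i)))"
  shows "definable_pred S (\<lambda>e. \<exists>x. P x e)"
proof -
  obtain \<phi> m where \<phi>: "wf_formula S \<phi>"
    "\<And>e. P (e 0) (\<lambda>i. e (Suc i)) \<longleftrightarrow> sat S (slot_env m e) \<phi>"
    by (rule definable_predE[OF assms]) blast
  \<comment> \<open>All slots filled by the bound variable are identified with the one that the quantifier binds.\<close>
  define \<rho> where "\<rho> i = (if m i = Inl 0 then 0 else Suc i)" for i
  define m' where "m' i = (case m i of Inl j \<Rightarrow> Inl (j - 1) | Inr a \<Rightarrow> Inr a)" for i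
  have "slot_env m (case_nat x e) = (\<lambda>i. case_nat x (slot_env m' e) (\<rho> i))" for x e
    by (auto simp: slot_env_def \<rho>_def m'_def split: sum.splits nat.splits)
  moreover have "P x e \<longleftrightarrow> sat S (slot_env m (case_nat x e)) \<phi>" for x e
    using \<phi>(2)[of "case_nat x e"] by simp
  ultimately have "(\<exists>x. P x e) \<longleftrightarrow> sat S (slot_env m' e) (Ex (rename \<rho> \<phi>))" for e
    by simp
  with \<phi>(1) show ?thesis
    by (intro definable_predI[where \<phi> = "Ex (rename \<rho> \<phi>)" and m = m']) simp_all
qed

lemma definable_pred_disj:
  assumes "definable_pred S P" "definable_pred S Q"
  shows "definable_pred S (\<lambda>e. P e \<or> Q e)"
  using definable_pred_neg[OF definable_pred_conj[OF assms[THEN definable_pred_neg]]] by simp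

lemma definable_pred_imp:
  assumes "definable_pred S P" "definable_pred S Q"
  shows "definable_pred S (\<lambda>e. P e \<longrightarrow> Q e)"
  using definable_pred_disj[OF definable_pred_neg[OF assms(1)] assms(2)] by (simp only: imp_conv_disj)

lemma definable_pred_iff:
  assumes "definable_pred S P" "definable_pred S Q"
  shows "definable_pred S (\<lambda>e. P e \<longleftrightarrow> Q e)"
  using definable_pred_conj[OF definable_pred_imp[OF assms] definable_pred_imp[OF assms(2,1)]]
  by (simp only: iff_conv_conj_imp)

lemma definable_pred_all:
  assumes "definable_pred S (\<lambda>e. P (e 0) (\<lambda>i. e (Suc i)))"
  shows "definable_pred S (\<lambda>e. \<forall>x. P x e)"
proof -
  have "definable_pred S (\<lambda>e. \<not> (\<exists>x. \<not> P x e))"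
    by (intro definable_pred_neg definable_pred_ex assms)
  then show ?thesis
    by (simp only: not_ex not_not)
qed

lemma definable_term_var: "definable_term S (\<lambda>e. e i)"
  unfolding definable_term_def
  by (rule exI[of _ "Var 0"], rule exI[of _ "\<lambda>_. Inl i"]) (simp add: slot_env_def)

lemma definable_term_const: "definable_term S (\<lambda>e. a)"
  unfolding definable_term_def
  by (rule exI[of _ "Var 0"], rule exI[of _ "\<lambda>_. Inr a"]) (simp add: slot_env_def)

lemma definable_terms_common_slots:
  assumes "definable_term S t" "definable_term S u"
  obtains \<tau> \<upsilon> m where "wf_term S \<tau>" "wf_term S \<upsilon>"
    "\<And>e. t e = eval_term S (slot_env m e) \<tau>" "\<And>e. u e = eval_term S (slot_env m e) \<upsilon>"
proof -
  obtain \<tau> m where \<tau>: "wf_term S \<tau>" "\<And>e. t e = eval_term S (slot_env m e) \<tau>"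
    using assms(1) unfolding definable_term_def by metis
  obtain \<upsilon> m' where \<upsilon>: "wf_term S \<upsilon>" "\<And>e. u e = eval_term S (slot_env m' e) \<upsilon>"
    using assms(2) unfolding definable_term_def by metis
  show ?thesis
    by (rule that[of "rename_term (\<lambda>i. 2 * i) \<tau>" "rename_term (\<lambda>i. Suc (2 * i)) \<upsilon>"
          "interleave m m'"]) (simp_all add: \<tau> \<upsilon> slot_env_interleave)
qed

lemma definable_pred_eq:
  assumes "definable_term S t" "definable_term S u"
  shows "definable_pred S (\<lambda>e. t e = u e)"
  by (rule definable_terms_common_slots[OF assms], rule definable_predI[where \<phi> = "Eq _ _"]) auto

text \<open>
  Slots filled by one of the first \<open>n\<close> variables become coordinates. The values
  \<open>d\<close> only serve to make the remaining variables of the environment parameters as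
  well.
\<close>

lemma definable_of_pred:
  assumes "definable_pred S P"
  shows "definable S n {xs. length xs = n \<and> P (point_env xs d)}"
proof -
  obtain \<phi> m where \<phi>: "wf_formula S \<phi>" "\<And>e. P e \<longleftrightarrow> sat S (slot_env m e) \<phi>"
    by (rule definable_predE[OF assms]) blast
  define \<rho> where "\<rho> i = (case m i of Inl j \<Rightarrow> if j < n then j else n + i | Inr a \<Rightarrow> n + i)" for i
  define p where "p i = (case m i of Inl j \<Rightarrow> d (j - n) | Inr a \<Rightarrow> a)" for i
  have "slot_env m (point_env xs d) = (\<lambda>i. point_env xs p (\<rho> i))" if "length xs = n" for xs
    using that by (auto simp: slot_env_def point_env_def \<rho>_def p_def split: sum.splits)
  then have "{xs. length xs = n \<and> P (point_env xs d)}
      = {xs. length xs = n \<and> sat S (point_env xs p) (rename \<rho> \<phi>)}"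
    using \<phi>(2) by auto
  then show ?thesis
    unfolding definable_def using \<phi>(1) wf_rename by blast
qed

lemma definable_pred_member:
  assumes "definable_subset S A"
  shows "definable_pred S (\<lambda>e. e i \<in> A)"
proof -
  obtain \<phi> p where \<phi>: "wf_formula S \<phi>"
    "{[x] | x. x \<in> A} = {xs. length xs = 1 \<and> sat S (point_env xs p) \<phi>}"
    using assms unfolding definable_subset_def definable_def by metis
  define m where "m = case_nat (Inl i) (\<lambda>k. Inr (p k))"
  have "x \<in> A \<longleftrightarrow> sat S (point_env [x] p) \<phi>" for x
    using \<phi>(2) by (auto dest: equalityD1 equalityD2 simp: set_eq_iff)
  moreover have "point_env [e i] p = slot_env m e" for e
    by (auto simp: point_env_def slot_env_def m_def split: nat.splits)
  ultimately show ?thesis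
    using \<phi>(1) by (intro definable_predI[where \<phi> = \<phi> and m = m]) simp_all
qed

locale ordered_group_expansion =
  fixes R :: "(real, 'f, 'r) fo_structure"
  assumes expands: "expands_ordered_group_real R"
begin

lemma definable_term_add:
  assumes "definable_term R t" "definable_term R u"
  shows "definable_term R (\<lambda>e. t e + u e)"
proof -
  obtain plus where plus: "fun_arity R plus = 2" "\<And>x y. fun_interp R plus [x, y] = x + y"
    using expands unfolding expands_ordered_group_real_def by blast
  obtain \<tau> \<upsilon> m where *: "wf_term R \<tau>" "wf_term R \<upsilon>"
    "\<And>e. t e = eval_term R (slot_env m e) \<tau>" "\<And>e. u e = eval_term R (slot_env m e) \<upsilon>"
    using definable_terms_common_slots[OF assms] by metis
  show ?thesis
    unfolding definable_term_def
    by (rule exI[of _ "Fun plus [\<tau>, \<upsilon>]"], rule exI[of _ m]) (simp add: * plus)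
qed

lemma definable_pred_less:
  assumes "definable_term R t" "definable_term R u"
  shows "definable_pred R (\<lambda>e. t e < u e)"
proof -
  obtain less where less: "rel_arity R less = 2" "\<And>x y. rel_interp R less [x, y] \<longleftrightarrow> x < y"
    using expands unfolding expands_ordered_group_real_def by blast
  obtain \<tau> \<upsilon> m where *: "wf_term R \<tau>" "wf_term R \<upsilon>"
    "\<And>e. t e = eval_term R (slot_env m e) \<tau>" "\<And>e. u e = eval_term R (slot_env m e) \<upsilon>"
    using definable_terms_common_slots[OF assms] by metis
  show ?thesis
    by (rule definable_predI[where \<phi> = "Rel less [\<tau>, \<upsilon>]" and m = m]) (simp_all add: * less)
qed

lemma definable_pred_le:
  assumes "definable_term R t" "definable_term R u"
  shows "definable_pred R (\<lambda>e. t e \<le> u e)"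
  using definable_pred_neg[OF definable_pred_less[OF assms(2,1)]] by (simp add: not_less)

lemmas definable_intros =
  definable_pred_neg definable_pred_conj definable_pred_disj definable_pred_imp definable_pred_iff
  definable_pred_ex definable_pred_all definable_pred_eq definable_pred_less definable_pred_le
  definable_term_add definable_term_var definable_term_const

end

section \<open>Coding sets of natural numbers by reals\<close>

text \<open>
  Finite sets \<open>G \<delta>\<close>, increasing as \<open>\<delta>\<close> decreases to
  \<open>0\<close>, whose union is dense in an interval: a dense set with a filtration that is as
  good as an enumeration, in a form that a first-order formula can speak about.
\<close>

locale finite_refinement =
  fixes G :: "real \<Rightarrow> real set" and a b :: real
  assumes interval: "a < b"
    and finite_level: "0 < \<delta> \<Longrightarrow> finite (G \<delta>)"
    and antimono: "0 < \<delta> \<Longrightarrow> \<delta> \<le> \<delta>' \<Longrightarrow> G \<delta>' \<subseteq> G \<delta>"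
    and within: "0 < \<delta> \<Longrightarrow> G \<delta> \<subseteq> {a<..<b}"
    and dense: "a \<le> x \<Longrightarrow> x < y \<Longrightarrow> y \<le> b \<Longrightarrow> \<exists>\<delta>>0. \<exists>z\<in>G \<delta>. x < z \<and> z < y"
begin

text \<open>
  The points that are at some stage of the filtration the best approximation of \<open>c\<close>
  from below.
\<close>

definition record_below :: "real \<Rightarrow> real \<Rightarrow> bool" where
  "record_below c p \<longleftrightarrow> p < c \<and> (\<exists>\<delta>>0. p \<in> G \<delta> \<and> (\<forall>q\<in>G \<delta>. q \<le> p \<or> c \<le> q))"

text \<open>
  Just above \<open>p\<close>, the next record can be fixed while \<open>c\<close> remains free to
  vary in a whole interval. Among the nonempty traces of the sets \<open>G \<delta>\<close> on
  \<open>(p, u)\<close> the smallest one, \<open>?M \<delta>\<close>, is the first to appear; its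
  last point \<open>p'\<close> is a record for every \<open>c\<close> in \<open>(p', u]\<close>. A
  record before \<open>p'\<close> would have to come from a trace without \<open>p'\<close>, hence
  from a smaller one.
\<close>

lemma ex_next_record:
  assumes "a \<le> p" "p < u" "u \<le> b"
  shows "\<exists>p'. p < p' \<and> p' < u \<and>
    (\<forall>c. p' < c \<longrightarrow> c \<le> u \<longrightarrow> record_below c p' \<and> (\<forall>q. p < q \<longrightarrow> record_below c q \<longrightarrow> p' \<le> q))"
proof -
  let ?M = "\<lambda>\<delta>. G \<delta> \<inter> {p<..<u}"
  obtain \<delta>0 where \<delta>0: "0 < \<delta>0 \<and> ?M \<delta>0 \<noteq> {}"
    using dense[OF assms] by fastforce
  obtain \<delta> where \<delta>: "0 < \<delta>" "?M \<delta> \<noteq> {}"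
    and least: "\<And>\<delta>'. 0 < \<delta>' \<Longrightarrow> ?M \<delta>' \<noteq> {} \<Longrightarrow> card (?M \<delta>) \<le> card (?M \<delta>')"
    using ex_has_least_nat[of "\<lambda>\<delta>. 0 < \<delta> \<and> ?M \<delta> \<noteq> {}" \<delta>0 "\<lambda>\<delta>. card (?M \<delta>)", OF \<delta>0] by metis
  have fin: "finite (?M \<delta>')" if "0 < \<delta>'" for \<delta>'
    using finite_level[OF that] by blast
  define p' where "p' = Max (?M \<delta>)"
  have p': "p' \<in> ?M \<delta>" and max: "\<And>q. q \<in> ?M \<delta> \<Longrightarrow> q \<le> p'"
    unfolding p'_def using Max_in[OF fin \<delta>(2)] Max_ge[OF fin] \<delta>(1) by blast+
  have rec: "record_below c p'" if "p' < c" "c \<le> u" for c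
  proof -
    have "q \<le> p' \<or> c \<le> q" if "q \<in> G \<delta>" for q
      using max[of q] that p' \<open>c \<le> u\<close> by force
    then show ?thesis
      unfolding record_below_def using p' \<delta>(1) \<open>p' < c\<close> by blast
  qed
  have "p' \<le> q" if c: "p' < c" "c \<le> u" and q: "p < q" "record_below c q" for c q
  proof (rule ccontr)
    assume "\<not> p' \<le> q"
    then have "q < p'" by simp
    obtain \<delta>' where \<delta>': "0 < \<delta>'" "q \<in> G \<delta>'" "\<forall>r\<in>G \<delta>'. r \<le> q \<or> c \<le> r"
      using q(2) unfolding record_below_def by blast
    have "p' \<notin> G \<delta>'"
      using \<delta>'(3) \<open>q < p'\<close> \<open>p' < c\<close> by force
    then have "\<not> \<delta>' \<le> \<delta>"
      using antimono[OF \<delta>'(1)] p' by blast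
    then have "?M \<delta>' \<subset> ?M \<delta>"
      using antimono[OF \<delta>(1), of \<delta>'] p' \<open>p' \<notin> G \<delta>'\<close> by auto
    then have "card (?M \<delta>') < card (?M \<delta>)"
      by (intro psubset_card_mono fin \<delta>)
    moreover have "?M \<delta>' \<noteq> {}"
      using \<delta>'(2) q(1) \<open>q < p'\<close> p' by force
    ultimately show False
      using least[OF \<delta>'(1)] by simp
  qed
  with rec show ?thesis
    using p' by (intro exI[of _ p']) auto
qed

definition consecutive :: "real \<Rightarrow> real \<Rightarrow> real \<Rightarrow> bool" where
  "consecutive \<delta> p q \<longleftrightarrow> p \<in> G \<delta> \<and> q \<in> G \<delta> \<and> p < q \<and> (\<forall>r\<in>G \<delta>. r \<le> p \<or> q \<le> r)"

text \<open>
  Membership in the closed first third, or in the closed fourth sixth, of an interval between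
  consecutive points. Both pieces are closed, which gives least codes, and they avoid the right
  endpoint, which keeps them disjoint also for neighbouring intervals. Division by three is not
  available in the language of ordered groups.
\<close>

definition in_first_third :: "real \<Rightarrow> real \<Rightarrow> bool" where
  "in_first_third \<delta> x \<longleftrightarrow> (\<exists>p q. consecutive \<delta> p q \<and> p \<le> x \<and> x + x + x \<le> q + p + p)"

definition in_fourth_sixth :: "real \<Rightarrow> real \<Rightarrow> bool" where
  "in_fourth_sixth \<delta> x \<longleftrightarrow> (\<exists>p q. consecutive \<delta> p q \<and> p + q \<le> x + x \<and> x + x + x \<le> p + q + q)"

lemma first_third_fourth_sixth_disjoint:
  assumes "in_first_third \<delta> x" shows "\<not> in_fourth_sixth \<delta> x"
proof
  assume "in_fourth_sixth \<delta> x"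
  then obtain p' q' where 1: "consecutive \<delta> p' q'" "p' + q' \<le> x + x" "x + x + x \<le> p' + q' + q'"
    unfolding in_fourth_sixth_def by blast
  obtain p q where 2: "consecutive \<delta> p q" "p \<le> x" "x + x + x \<le> q + p + p"
    using assms unfolding in_first_third_def by blast
  have "p < q" "p' < q'" "p' \<le> p \<or> q \<le> p'" "p \<le> p' \<or> q' \<le> p" "q' \<le> p \<or> q \<le> q'" "q \<le> p' \<or> q' \<le> q"
    using 1(1) 2(1) unfolding consecutive_def by blast+
  with 1(2,3) 2(2,3) show False by argo
qed

lemma finite_consecutive:
  assumes "0 < \<delta>" shows "finite {(p, q). consecutive \<delta> p q}"
  by (rule finite_subset[of _ "G \<delta> \<times> G \<delta>"]) (auto simp: consecutive_def finite_level[OF assms])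

lemma closed_in_first_third:
  assumes "0 < \<delta>" shows "closed {x. in_first_third \<delta> x}"
proof -
  have third: "p \<le> x \<and> x + x + x \<le> q + p + p \<longleftrightarrow> x \<in> {p..(q + p + p) / 3}" for p q x :: real
    by auto
  have "{x. in_first_third \<delta> x} = (\<Union>(p, q)\<in>{(p, q). consecutive \<delta> p q}. {p..(q + p + p) / 3})"
    unfolding in_first_third_def third by (auto simp del: atLeastAtMost_iff)
  then show ?thesis
    using finite_consecutive[OF assms] by auto
qed

lemma closed_in_fourth_sixth:
  assumes "0 < \<delta>" shows "closed {x. in_fourth_sixth \<delta> x}"
proof -
  have sixth: "p + q \<le> x + x \<and> x + x + x \<le> p + q + q \<longleftrightarrow> x \<in> {(p + q) / 2..(p + q + q) / 3}"
    for p q x :: real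
    by auto
  have "{x. in_fourth_sixth \<delta> x} =
      (\<Union>(p, q)\<in>{(p, q). consecutive \<delta> p q}. {(p + q) / 2..(p + q + q) / 3})"
    unfolding in_fourth_sixth_def sixth by (auto simp del: atLeastAtMost_iff)
  then show ?thesis
    using finite_consecutive[OF assms] by auto
qed

text \<open>
  Two points of \<open>G \<delta>\<close> in \<open>[l, r]\<close> are what is needed for an
  interval between consecutive points to fit into \<open>[l, r]\<close>.
\<close>

definition meets_twice :: "real \<Rightarrow> real \<Rightarrow> real \<Rightarrow> bool" where
  "meets_twice \<delta> l r \<longleftrightarrow> (\<exists>x\<in>G \<delta>. \<exists>y\<in>G \<delta>. l \<le> x \<and> x < y \<and> y \<le> r)"

lemma ex_consecutive:
  assumes "0 < \<delta>" "meets_twice \<delta> l r"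
  shows "\<exists>p q. consecutive \<delta> p q \<and> l \<le> p \<and> q \<le> r"
proof -
  obtain x y where xy: "x \<in> G \<delta>" "y \<in> G \<delta>" "l \<le> x" "x < y" "y \<le> r"
    using assms(2) unfolding meets_twice_def by blast
  let ?Z = "{z\<in>G \<delta>. x < z}"
  have fin: "finite ?Z" and ne: "?Z \<noteq> {}"
    using finite_level[OF assms(1)] xy by auto
  have "r \<le> x \<or> Min ?Z \<le> r" if "r \<in> G \<delta>" for r
    using Min_le[OF fin, of r] that by force
  then have "consecutive \<delta> x (Min ?Z)"
    using Min_in[OF fin ne] xy(1) unfolding consecutive_def by blast
  moreover have "Min ?Z \<le> r"
    using Min_le[OF fin, of y] xy by auto
  ultimately show ?thesis
    using xy(3) by blast
qed

lemma eventually_meets_twice: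
  assumes "a \<le> l" "l < r" "r \<le> b"
  shows "\<forall>\<^sub>F \<delta> in at_right 0. meets_twice \<delta> l r"
proof -
  obtain \<delta>1 x where x: "0 < \<delta>1" "x \<in> G \<delta>1" "l < x" "x < r"
    using dense[OF assms] by blast
  obtain \<delta>2 y where y: "0 < \<delta>2" "y \<in> G \<delta>2" "x < y" "y < r"
    using dense[of x r] assms x by auto
  have "meets_twice \<delta> l r" if "0 < \<delta>" "\<delta> < min \<delta>1 \<delta>2" for \<delta>
    using antimono[OF that(1), of \<delta>1] antimono[OF that(1), of \<delta>2] that x y
    unfolding meets_twice_def by (intro bexI[of _ x] bexI[of _ y]) auto
  then show ?thesis
    unfolding eventually_at_right_field using x(1) y(1) by (intro exI[of _ "min \<delta>1 \<delta>2"]) auto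
qed

text \<open>
  The next level is fine enough to make either choice at level \<open>\<delta>'\<close> whatever
  has been chosen at level \<open>\<delta>\<close>. As \<open>G \<delta>\<close> is finite, this
  holds for all sufficiently small \<open>\<delta>'\<close>, with a bound that depends on
  \<open>\<delta>\<close> alone; a sequence of levels can therefore be chosen without reference to
  the sets to be coded.
\<close>

definition splits :: "real \<Rightarrow> real \<Rightarrow> bool" where
  "splits \<delta> \<delta>' \<longleftrightarrow> (\<forall>p q. consecutive \<delta> p q \<longrightarrow>
     meets_twice \<delta>' p ((q + p + p) / 3) \<and> meets_twice \<delta>' ((p + q) / 2) ((p + q + q) / 3))"

lemma eventually_splits:
  assumes "0 < \<delta>" shows "\<forall>\<^sub>F \<delta>' in at_right 0. splits \<delta> \<delta>'"
proof -
  have "\<forall>\<^sub>F \<delta>' in at_right 0.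
      meets_twice \<delta>' p ((q + p + p) / 3) \<and> meets_twice \<delta>' ((p + q) / 2) ((p + q + q) / 3)"
    if "consecutive \<delta> p q" for p q
  proof -
    have "p < q" "a < p" "q < b"
      using that within[OF assms] unfolding consecutive_def by auto
    then show ?thesis
      by (intro eventually_conj eventually_meets_twice) (simp_all add: field_simps)
  qed
  then have "\<forall>\<^sub>F \<delta>' in at_right 0. \<forall>(p, q)\<in>{(p, q). consecutive \<delta> p q}.
      meets_twice \<delta>' p ((q + p + p) / 3) \<and> meets_twice \<delta>' ((p + q) / 2) ((p + q + q) / 3)"
    by (intro eventually_ball_finite finite_consecutive[OF assms]) auto
  then show ?thesis
    by eventually_elim (auto simp: splits_def)
qed

text \<open>
  Intervals between consecutive points of \<open>G (d i)\<close> are chosen successively, each one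
  inside the piece of the previous one that \<open>T\<close> prescribes. The intersection of these
  pieces is nonempty by compactness.
\<close>

lemma ex_least_code:
  assumes pos: "\<And>i. 0 < d i" and fast: "\<And>i. splits (d i) (d (Suc i))" and start: "meets_twice (d 0) a b"
  shows "\<exists>x. (\<forall>i. if i \<in> T then in_first_third (d i) x else in_fourth_sixth (d i) x) \<and>
    (\<forall>y. (\<forall>i. if i \<in> T then in_first_third (d i) y else in_fourth_sixth (d i) y) \<longrightarrow> x \<le> y)"
proof -
  define C where "C i = (if i \<in> T then {x. in_first_third (d i) x} else {x. in_fourth_sixth (d i) x})" for i
  define part where "part i z = (case z of (p, q) \<Rightarrow>
    if i \<in> T then {p..(q + p + p) / 3} else {(p + q) / 2..(p + q + q) / (3::real)})" for i z
  have "\<exists>z. \<forall>i. (case z i of (p, q) \<Rightarrow> consecutive (d i) p q)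
      \<and> (case z (Suc i) of (p, q) \<Rightarrow> {p..q}) \<subseteq> part i (z i)"
  proof (rule dependent_nat_choice)
    show "\<exists>z. case z of (p, q) \<Rightarrow> consecutive (d 0) p q"
      using ex_consecutive[OF pos start] by auto
  next
    fix z i assume "case z of (p, q) \<Rightarrow> consecutive (d i) p q"
    then obtain p q where z: "z = (p, q)" "consecutive (d i) p q" by auto
    obtain l r where lr: "part i z = {l..r}" "meets_twice (d (Suc i)) l r"
    proof (cases "i \<in> T")
      case True
      then show thesis
        using that[of p "(q + p + p) / 3"] fast[of i] z by (simp add: part_def splits_def)
    next
      case False
      then show thesis
        using that[of "(p + q) / 2" "(p + q + q) / 3"] fast[of i] z by (simp add: part_def splits_def)
    qed
    obtain p' q' where "consecutive (d (Suc i)) p' q'" "l \<le> p'" "q' \<le> r"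
      using ex_consecutive[OF pos lr(2)] by blast
    then show "\<exists>z'. (case z' of (p, q) \<Rightarrow> consecutive (d (Suc i)) p q)
        \<and> (case z' of (p, q) \<Rightarrow> {p..q}) \<subseteq> part i z"
      using lr(1) by (intro exI[of _ "(p', q')"]) auto
  qed
  then obtain z where *: "\<forall>i. (case z i of (p, q) \<Rightarrow> consecutive (d i) p q)
      \<and> (case z (Suc i) of (p, q) \<Rightarrow> {p..q}) \<subseteq> part i (z i)" ..
  then have z: "case z i of (p, q) \<Rightarrow> consecutive (d i) p q"
    and nested: "(case z (Suc i) of (p, q) \<Rightarrow> {p..q}) \<subseteq> part i (z i)" for i
    by iprover+
  have part: "compact (part i (z i)) \<and> part i (z i) \<noteq> {} \<and> part i (z i) \<subseteq> C i
      \<and> part i (z i) \<subseteq> (case z i of (p, q) \<Rightarrow> {p..q})" for i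
  proof -
    obtain p q where pq: "z i = (p, q)" "consecutive (d i) p q"
      using z[of i] by (cases "z i") auto
    then have "p < q" by (simp add: consecutive_def)
    show ?thesis
    proof (cases "i \<in> T")
      case True
      have "in_first_third (d i) x" if "x \<in> {p..(q + p + p) / 3}" for x
        unfolding in_first_third_def using pq(2) that by (intro exI[of _ p] exI[of _ q]) auto
      with True pq(1) \<open>p < q\<close> show ?thesis
        by (auto simp: part_def C_def)
    next
      case False
      have "in_fourth_sixth (d i) x" if "x \<in> {(p + q) / 2..(p + q + q) / 3}" for x
        unfolding in_fourth_sixth_def using pq(2) that by (intro exI[of _ p] exI[of _ q]) auto
      with False pq(1) \<open>p < q\<close> show ?thesis
        by (auto simp: part_def C_def)
    qed
  qed
  have Suc: "part (Suc i) (z (Suc i)) \<subseteq> part i (z i)" for i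
    using part[of "Suc i"] by (intro order_trans[OF _ nested]) simp
  have "\<Inter> (range (\<lambda>i. part i (z i))) \<noteq> {}"
  proof (rule compact_nest)
    show "part j (z j) \<subseteq> part i (z i)" if "i \<le> j" for i j
      using lift_Suc_antimono_le[of "\<lambda>i. part i (z i)", OF Suc that] .
  qed (simp_all add: part)
  then obtain x where "\<And>i. x \<in> part i (z i)"
    by auto
  then have "x \<in> C i" for i
    using part[of i] by (meson subsetD)
  then have ne: "(\<Inter>i. C i) \<noteq> {}"
    by auto
  \<comment> \<open>The least code exists because the set of all codes is compact, being closed and contained in \<open>{a..b}\<close>.\<close>
  have "C 0 \<subseteq> {a..b}"
  proof
    fix x assume "x \<in> C 0"
    then consider "in_first_third (d 0) x" | "in_fourth_sixth (d 0) x"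
      unfolding C_def by (auto split: if_splits)
    then obtain p q where "consecutive (d 0) p q" "p \<le> x" "x \<le> q"
    proof cases
      case 1
      then show thesis
        using that unfolding in_first_third_def consecutive_def by force
    next
      case 2
      then show thesis
        using that unfolding in_fourth_sixth_def consecutive_def by force
    qed
    then show "x \<in> {a..b}"
      using within[OF pos[of 0]] unfolding consecutive_def by force
  qed
  moreover have "closed (C i)" for i
    using closed_in_first_third[OF pos] closed_in_fourth_sixth[OF pos] by (simp add: C_def)
  ultimately have "compact ({a..b} \<inter> (\<Inter>i. C i))" "{a..b} \<inter> (\<Inter>i. C i) = (\<Inter>i. C i)"
    by (auto intro!: compact_Int_closed)
  then have "compact (\<Inter>i. C i)"
    by simp
  then obtain x where "x \<in> (\<Inter>i. C i)" "\<And>y. y \<in> (\<Inter>i. C i) \<Longrightarrow> x \<le> y"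
    using compact_attains_inf[OF _ ne] by blast
  moreover have "y \<in> (\<Inter>i. C i) \<longleftrightarrow>
      (\<forall>i. if i \<in> T then in_first_third (d i) y else in_fourth_sixth (d i) y)" for y
    by (auto simp: C_def split: if_splits)
  ultimately show ?thesis
    by metis
qed

text \<open>
  The reals \<open>p i\<close> and \<open>u i\<close> are chosen alternately, where
  \<open>c\<close> will end up in \<open>(p i, u i]\<close>. First \<open>p (i + 1)\<close> is the
  next record after \<open>p i\<close>; then \<open>u (i + 1)\<close> is taken so close to it that
  every later difference, \<open>p (i + 2) - p (i + 1)\<close> in particular, is small in
  comparison with \<open>p (i + 1) - p i\<close>. The sequence of the lemma starts with \<open>p
  1\<close>, because \<open>p 0\<close> is just the endpoint where the construction begins.
\<close>

lemma ex_fast_records: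
  "\<exists>p0 c n. strict_mono n \<and> {p. p0 < p \<and> record_below c p} = range n \<and>
    (\<forall>i::nat. splits (n (Suc i) - n i) (n (Suc (Suc i)) - n (Suc i))) \<and>
    meets_twice (n (Suc 0) - n 0) a b"
proof -
  define next_to where "next_to = (\<lambda>(p, u) (p', u'). p < p' \<and> p' < u \<and> u' \<le> u \<and>
    (\<forall>c. p' < c \<longrightarrow> c \<le> u \<longrightarrow> record_below c p' \<and> (\<forall>q. p < q \<longrightarrow> record_below c q \<longrightarrow> p' \<le> q)) \<and>
    (\<forall>\<delta>. 0 < \<delta> \<longrightarrow> \<delta> < u' - p' \<longrightarrow> splits (p' - p) \<delta> \<and> meets_twice \<delta> a b))"
  have "\<exists>z. \<forall>i::nat. (case z i of (p, u) \<Rightarrow> a \<le> p \<and> p < u \<and> u \<le> b) \<and> next_to (z i) (z (Suc i))"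
  proof (rule dependent_nat_choice)
    show "\<exists>z. case z of (p, u) \<Rightarrow> a \<le> p \<and> p < u \<and> u \<le> b"
      using interval by auto
  next
    fix z i assume "case z of (p, u) \<Rightarrow> a \<le> p \<and> p < u \<and> u \<le> b"
    then obtain p u where z: "z = (p, u)" "a \<le> p" "p < u" "u \<le> b" by auto
    obtain p' where p': "p < p'" "p' < u"
      "\<forall>c. p' < c \<longrightarrow> c \<le> u \<longrightarrow> record_below c p' \<and> (\<forall>q. p < q \<longrightarrow> record_below c q \<longrightarrow> p' \<le> q)"
      using ex_next_record[OF z(2-4)] by blast
    have "\<forall>\<^sub>F \<delta> in at_right 0. splits (p' - p) \<delta> \<and> meets_twice \<delta> a b"
      using p' interval by (intro eventually_conj eventually_splits eventually_meets_twice) auto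
    then obtain \<eta> where \<eta>: "0 < \<eta>" "\<And>\<delta>. 0 < \<delta> \<Longrightarrow> \<delta> < \<eta> \<Longrightarrow> splits (p' - p) \<delta> \<and> meets_twice \<delta> a b"
      unfolding eventually_at_right_field by blast
    have "next_to z (p', min u (p' + \<eta>))"
      unfolding next_to_def z(1) prod.case using p' \<eta>(2) by auto
    then show "\<exists>z'. (case z' of (p, u) \<Rightarrow> a \<le> p \<and> p < u \<and> u \<le> b) \<and> next_to z z'"
      using z p' \<eta>(1) by (intro exI[of _ "(p', min u (p' + \<eta>))"]) auto
  qed
  then obtain z where *: "\<forall>i::nat. (case z i of (p, u) \<Rightarrow> a \<le> p \<and> p < u \<and> u \<le> b)
      \<and> next_to (z i) (z (Suc i))" ..
  then have z: "case z i of (p, u) \<Rightarrow> a \<le> p \<and> p < u \<and> u \<le> b" "next_to (z i) (z (Suc i))" for i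
    by iprover+
  define p where "p i = fst (z i)" for i
  define u where "u i = snd (z i)" for i
  have pu: "p i < u i" and step: "next_to (p i, u i) (p (Suc i), u (Suc i))" for i
    using z(1)[of i] z(2)[of i] unfolding p_def u_def by (auto split: prod.splits)
  have mono: "strict_mono p"
    using step unfolding strict_mono_Suc_iff next_to_def by simp
  have "decseq u"
    using step unfolding decseq_Suc_iff next_to_def by simp
  have below_u: "p j \<le> u i" for i j
    using pu[of "max i j"] monoD[OF strict_mono_mono[OF mono], of j "max i j"]
      decseqD[OF \<open>decseq u\<close>, of i "max i j"] by linarith
  define c where "c = (SUP i. p i)"
  have bdd: "bdd_above (range p)"
    using below_u[of _ 0] by (rule bdd_aboveI2)
  have p_less_c: "p i < c" for i
    using cSUP_upper[OF _ bdd, of "Suc i"] strict_monoD[OF mono, of i "Suc i"] unfolding c_def by simp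
  have c_le_u: "c \<le> u i" for i
    unfolding c_def by (intro cSUP_least below_u) auto
  have rec: "record_below c (p (Suc i))"
    and skip: "p i < q \<Longrightarrow> record_below c q \<Longrightarrow> p (Suc i) \<le> q" for i q
    using step[of i] p_less_c[of "Suc i"] c_le_u[of i] unfolding next_to_def by auto
  have "{q. p 0 < q \<and> record_below c q} = range (\<lambda>i. p (Suc i))"
  proof (intro equalityI subsetI)
    fix q assume "q \<in> range (\<lambda>i. p (Suc i))"
    then show "q \<in> {q. p 0 < q \<and> record_below c q}"
      using rec strict_monoD[OF mono, of 0] by auto
  next
    fix q assume "q \<in> {q. p 0 < q \<and> record_below c q}"
    then have q: "p 0 < q" "record_below c q" by auto
    then have "\<exists>i. q \<le> p i"
      using less_cSUP_iff[OF _ bdd, of q] unfolding c_def record_below_def by (auto intro: less_imp_le)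
    then obtain i where i: "q \<le> p i" "\<And>j. j < i \<Longrightarrow> \<not> q \<le> p j"
      by (meson exists_least_iff)
    then obtain j where j: "i = Suc j"
      using q(1) by (cases i) auto
    then show "q \<in> range (\<lambda>i. p (Suc i))"
      using skip[of j q] q(2) i(1) i(2)[of j] by force
  qed
  moreover have "strict_mono (\<lambda>i. p (Suc i))"
    using mono by (simp add: strict_mono_Suc_iff)
  moreover have fast: "splits (p (Suc i) - p i) (p (Suc (Suc i)) - p (Suc i))
      \<and> meets_twice (p (Suc (Suc i)) - p (Suc i)) a b" for i
    using step[of i] step[of "Suc i"] p_less_c[of "Suc (Suc i)"] c_le_u[of "Suc i"]
    unfolding next_to_def by auto
  ultimately show ?thesis
    by (intro exI[of _ "p 0"] exI[of _ c] exI[of _ "\<lambda>i. p (Suc i)"]) auto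
qed

end
section \<open>Copies of the monadic structure on lines of reals\<close>

lemma definable_unary:
  assumes "definable_pred S (\<lambda>e. Q (e 0))"
  shows "definable S 1 {[x] | x. Q x}"
proof -
  have "{[x] | x. Q x} = {xs. length xs = 1 \<and> Q (point_env xs (\<lambda>_. undefined) 0)}"
    by (auto simp: point_env_def length_Suc_conv)
  then show ?thesis
    using definable_of_pred[OF assms] by simp
qed

lemma definable_binary:
  assumes "definable_pred S (\<lambda>e. Q (e 0) (e 1))"
  shows "definable S 2 {[x, y] | x y. Q x y}"
proof -
  have "{[x, y] | x y. Q x y} = {xs. length xs = 2 \<and>
      Q (point_env xs (\<lambda>_. undefined) 0) (point_env xs (\<lambda>_. undefined) 1)}"
    by (auto simp: point_env_def length_Suc_conv numeral_2_eq_2)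
  then show ?thesis
    using definable_of_pred[OF assms] by simp
qed

definition adjacent_in :: "real set \<Rightarrow> real \<Rightarrow> real \<Rightarrow> bool" where
  "adjacent_in N p q \<longleftrightarrow> p \<in> N \<and> q \<in> N \<and> p < q \<and> (\<forall>r\<in>N. r \<le> p \<or> q \<le> r)"

lemma adjacent_in_range_iff:
  assumes "strict_mono n"
  shows "adjacent_in (range n) (n i) q \<longleftrightarrow> q = n (Suc i)"
proof
  assume *: "adjacent_in (range n) (n i) q"
  then obtain j where j: "q = n j" unfolding adjacent_in_def by blast
  then have "i < j" "n (Suc i) \<le> n i \<or> n j \<le> n (Suc i)"
    using * assms unfolding adjacent_in_def by (auto simp: strict_mono_less)
  then show "q = n (Suc i)"
    using assms j by (auto simp: strict_mono_less_eq le_Suc_eq)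
qed (use assms in \<open>auto simp: adjacent_in_def strict_mono_less strict_mono_less_eq not_less_eq_eq\<close>)

context ordered_group_expansion
begin

lemma definable_pred_adjacent_in:
  assumes "\<And>i. definable_pred R (\<lambda>e. e i \<in> N)"
  shows "definable_pred R (\<lambda>e. adjacent_in N (e i) (e j))"
  unfolding adjacent_in_def Ball_def by (intro definable_intros assms)

text \<open>
  One real codes each number and one real codes each set, so only unary and binary predicates have
  to be definable. The successor comes for free: on the range of an increasing sequence it is
  determined by the order.
\<close>

lemma defines_B_if_sets_coded:
  fixes n :: "nat \<Rightarrow> real"
  assumes n: "strict_mono n" "\<And>i. definable_pred R (\<lambda>e. e i \<in> range n)"
    and P: "\<And>i. definable_pred R (\<lambda>e. e i \<in> P)"
    and digit: "definable_pred R (\<lambda>e. digit (e 0) (e 1))"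
    and code: "\<And>T. \<exists>!x. x \<in> P \<and> (\<forall>i. digit (n i) x \<longleftrightarrow> i \<in> T)"
  shows "defines_B R"
proof -
  have inv: "inv n (n i) = i" for i
    using n(1) by (simp add: strict_mono_imp_inj_on)
  have next_iff: "adjacent_in (range n) x y \<longleftrightarrow> x \<in> range n \<and> y = n (Suc (inv n x))" for x y
  proof (cases "x \<in> range n")
    case True
    then obtain i where "x = n i" ..
    then show ?thesis
      by (simp add: adjacent_in_range_iff[OF n(1)] inv)
  qed (simp add: adjacent_in_def)
  define M where "M = \<lparr>set_sort = {[y] | y. y \<in> P}, num_sort = {[x] | x. x \<in> range n},
    mem_rel = {([x], [y]) | x y. x \<in> range n \<and> y \<in> P \<and> digit x y},
    succ_fun = (\<lambda>xs. [n (Suc (inv n (hd xs)))])\<rparr>"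
  have "definable_two_sorted R M"
    unfolding definable_two_sorted_def
  proof (intro exI[of _ 1] conjI)
    show "definable R 1 (num_sort M)" "definable R 1 (set_sort M)"
      using definable_unary[of R "\<lambda>x. x \<in> range n", OF n(2)]
        definable_unary[of R "\<lambda>y. y \<in> P", OF P] by (simp_all add: M_def)
    show "mem_rel M \<subseteq> num_sort M \<times> set_sort M" "succ_fun M ` num_sort M \<subseteq> num_sort M"
      by (auto simp: M_def)
    have "{xs @ ys | xs ys. (xs, ys) \<in> mem_rel M} = {[x, y] | x y. x \<in> range n \<and> y \<in> P \<and> digit x y}"
    proof (intro subset_antisym subsetI)
      fix zs assume "zs \<in> {[x, y] | x y. x \<in> range n \<and> y \<in> P \<and> digit x y}"
      then obtain x y where "zs = [x] @ [y]" "([x], [y]) \<in> mem_rel M"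
        by (auto simp: M_def)
      then show "zs \<in> {xs @ ys | xs ys. (xs, ys) \<in> mem_rel M}" by blast
    qed (auto simp: M_def)
    then show "definable R (1 + 1) {xs @ ys | xs ys. (xs, ys) \<in> mem_rel M}"
      using definable_binary[of R "\<lambda>x y. x \<in> range n \<and> y \<in> P \<and> digit x y",
          OF definable_pred_conj[OF n(2) definable_pred_conj[OF P digit]]]
      by (simp add: numeral_2_eq_2)
    have "{xs @ succ_fun M xs | xs. xs \<in> num_sort M}
        = {[x, y] | x y. x \<in> range n \<and> y = n (Suc (inv n x))}"
      unfolding M_def by auto
    then show "definable R (1 + 1) {xs @ succ_fun M xs | xs. xs \<in> num_sort M}"
      using definable_binary[of R "adjacent_in (range n)", OF definable_pred_adjacent_in[OF n(2)]]
      by (simp add: next_iff numeral_2_eq_2)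
  qed
  moreover have "two_sorted_isomorphic M structure_B"
    unfolding two_sorted_isomorphic_def
  proof (intro exI conjI ballI)
    let ?g = "\<lambda>ys. {i. digit (n i) (hd ys)}" and ?h = "\<lambda>xs. inv n (hd xs)"
    show "bij_betw ?g (set_sort M) (set_sort structure_B)"
    proof (rule bij_betwI')
      fix xs ys assume "xs \<in> set_sort M" "ys \<in> set_sort M"
      then obtain x y where xy: "xs = [x]" "ys = [y]" "x \<in> P" "y \<in> P"
        by (auto simp: M_def)
      then show "?g xs = ?g ys \<longleftrightarrow> xs = ys"
        using code[of "?g ys"] by (auto simp: set_eq_iff)
    next
      fix T :: "nat set"
      obtain x where "x \<in> P" "\<forall>i. digit (n i) x \<longleftrightarrow> i \<in> T"
        using code[of T] by blast
      then show "\<exists>xs\<in>set_sort M. T = ?g xs"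
        by (intro bexI[of _ "[x]"]) (auto simp: M_def)
    qed (simp add: structure_B_def)
    show "bij_betw ?h (num_sort M) (num_sort structure_B)"
      by (rule bij_betwI[where g = "\<lambda>i. [n i]"]) (auto simp: M_def structure_B_def inv)
    show "(xs, ys) \<in> mem_rel M \<longleftrightarrow> (?h xs, ?g ys) \<in> mem_rel structure_B"
      if "xs \<in> num_sort M" "ys \<in> set_sort M" for xs ys
      using that by (auto simp: M_def structure_B_def inv)
    show "?h (succ_fun M xs) = succ_fun structure_B (?h xs)" if "xs \<in> num_sort M" for xs
      using that by (auto simp: M_def structure_B_def inv)
  qed
  ultimately show ?thesis
    unfolding defines_B_def by blast
qed

end

locale definable_refinement = ordered_group_expansion R + finite_refinement G a b
  for R :: "(real, 'f, 'r) fo_structure" and G a b +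
  assumes definable_level: "definable_pred R (\<lambda>e. e i \<in> G (e j))"
begin

lemma definable_record_below: "definable_pred R (\<lambda>e. record_below c (e i))"
  unfolding record_below_def Ball_def by (intro definable_intros definable_level)

lemma definable_consecutive: "definable_pred R (\<lambda>e. consecutive (e i) (e j) (e k))"
  unfolding consecutive_def Ball_def by (intro definable_intros definable_level)

lemma definable_in_first_third: "definable_pred R (\<lambda>e. in_first_third (e i) (e j))"
  unfolding in_first_third_def by (intro definable_intros definable_consecutive)

lemma definable_in_fourth_sixth: "definable_pred R (\<lambda>e. in_fourth_sixth (e i) (e j))"
  unfolding in_fourth_sixth_def by (intro definable_intros definable_consecutive)

text \<open>
  The digit at \<open>n i\<close> refers to the level \<open>d i = n (i + 1) - n i\<close>. It is
  computed from the number \<open>n i\<close> alone by way of adjacency in the range of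
  \<open>n\<close>, and this makes the relation between numbers and sets definable.
\<close>

theorem defines_B: "defines_B R"
proof -
  obtain p0 c n where n: "strict_mono n" and rec: "{p. p0 < p \<and> record_below c p} = range n"
    and splits: "\<And>i::nat. splits (n (Suc i) - n i) (n (Suc (Suc i)) - n (Suc i))"
    and start: "meets_twice (n (Suc 0) - n 0) a b"
    using ex_fast_records by blast
  define d where "d i = n (Suc i) - n i" for i
  have d_pos: "0 < d i" for i
    using n by (simp add: d_def strict_mono_less)
  define one where "one p x \<longleftrightarrow> (\<exists>q \<delta>. adjacent_in (range n) p q \<and> p + \<delta> = q \<and> in_first_third \<delta> x)" for p x
  define zero where "zero p x \<longleftrightarrow> (\<exists>q \<delta>. adjacent_in (range n) p q \<and> p + \<delta> = q \<and> in_fourth_sixth \<delta> x)" for p x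
  have gap: "n i + \<delta> = n (Suc i) \<longleftrightarrow> \<delta> = d i" for i \<delta>
    unfolding d_def by auto
  have one_iff: "one (n i) x \<longleftrightarrow> in_first_third (d i) x"
    and zero_iff: "zero (n i) x \<longleftrightarrow> in_fourth_sixth (d i) x" for i x
    by (simp_all add: one_def zero_def adjacent_in_range_iff[OF n] gap)
  define code where "code x \<longleftrightarrow> (\<forall>p\<in>range n. one p x \<or> zero p x)" for x
  \<comment> \<open>The least element of each class of codes with the same digits.\<close>
  define P where "P = {x. code x \<and> (\<forall>y. code y \<longrightarrow> (\<forall>p\<in>range n. one p x \<longleftrightarrow> one p y) \<longrightarrow> x \<le> y)}"
  have code_iff: "code x \<and> (\<forall>i. one (n i) x \<longleftrightarrow> i \<in> T)
      \<longleftrightarrow> (\<forall>i. if i \<in> T then in_first_third (d i) x else in_fourth_sixth (d i) x)" for x T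
    using first_third_fourth_sixth_disjoint unfolding code_def
    by (auto simp: one_iff zero_iff)
  show ?thesis
  proof (rule defines_B_if_sets_coded[OF n, of P one])
    show range: "definable_pred R (\<lambda>e. e i \<in> range n)" for i
      unfolding rec[symmetric] mem_Collect_eq by (intro definable_intros definable_record_below)
    note adjacent = definable_pred_adjacent_in[of "range n", OF range]
    have one: "definable_pred R (\<lambda>e. one (e i) (e j))" for i j
      unfolding one_def by (intro definable_intros adjacent definable_in_first_third)
    have zero: "definable_pred R (\<lambda>e. zero (e i) (e j))" for i j
      unfolding zero_def by (intro definable_intros adjacent definable_in_fourth_sixth)
    have code: "definable_pred R (\<lambda>e. code (e i))" for i
      unfolding code_def Ball_def by (intro definable_intros range one zero)
    show "definable_pred R (\<lambda>e. e i \<in> P)" for i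
      unfolding P_def mem_Collect_eq Ball_def by (intro definable_intros range one code)
    show "definable_pred R (\<lambda>e. one (e 0) (e 1))"
      by (rule one)
  next
    fix T
    obtain x where x: "code x" "\<And>i. one (n i) x \<longleftrightarrow> i \<in> T"
      and least: "\<And>y. code y \<Longrightarrow> \<forall>i. one (n i) y \<longleftrightarrow> i \<in> T \<Longrightarrow> x \<le> y"
      using ex_least_code[of d T, folded code_iff] d_pos splits start unfolding d_def by blast
    show "\<exists>!x. x \<in> P \<and> (\<forall>i. one (n i) x \<longleftrightarrow> i \<in> T)"
    proof (rule ex1I)
      show "x \<in> P \<and> (\<forall>i. one (n i) x \<longleftrightarrow> i \<in> T)"
        using x least unfolding P_def by auto
      show "y = x" if "y \<in> P \<and> (\<forall>i. one (n i) y \<longleftrightarrow> i \<in> T)" for y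
        using that x least[of y] unfolding P_def by (intro antisym) auto
    qed
  qed
qed

end

section \<open>Gaps of a nowhere dense set of positive measure\<close>

text \<open>
  Steinhaus' theorem for compact sets: a slight translate of \<open>K\<close> stays in an open set
  \<open>U\<close> of measure less than twice that of \<open>K\<close>, which has no room for two
  disjoint copies of \<open>K\<close>.
\<close>

lemma ex_differences_near_zero:
  fixes K :: "real set"
  assumes "compact K" "K \<notin> null_sets lebesgue"
  shows "\<exists>\<eta>>0. \<forall>t. \<bar>t\<bar> < \<eta> \<longrightarrow> (\<exists>x\<in>K. x + t \<in> K)"
proof -
  have K: "K \<in> lmeasurable"
    using assms(1) by (rule lmeasurable_compact)
  have pos: "0 < measure lebesgue K"
    using assms(2) K measure_nonneg[of lebesgue K]
    by (simp add: null_sets_def fmeasurableD emeasure_eq_measure2 less_le)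
  obtain U where U: "open U" "K \<subseteq> U" "U - K \<in> lmeasurable"
    "emeasure lebesgue (U - K) < ennreal (measure lebesgue K)"
    using sets_lebesgue_outer_open[OF fmeasurableD[OF K] pos] .
  have U_meas: "U \<in> lmeasurable"
    using fmeasurable.Un[OF K U(3)] U(2) by (simp add: Un_absorb1)
  have "measure lebesgue (U - K) < measure lebesgue K"
    using U(3,4) pos by (simp add: emeasure_eq_measure2 ennreal_less_iff)
  then have small: "measure lebesgue U < 2 * measure lebesgue K"
    using measurable_measure_Diff[OF U_meas fmeasurableD[OF K] U(2)] by simp
  have "K \<noteq> {}"
    using assms(2) by auto
  then obtain \<eta> where \<eta>: "0 < \<eta>" "{x. infdist x K \<le> \<eta>} \<subseteq> U"
    using compact_in_open_separated[OF _ assms(1) U(1,2)] by blast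
  have "\<exists>x\<in>K. x + t \<in> K" if t: "\<bar>t\<bar> < \<eta>" for t
  proof (rule ccontr)
    assume "\<not> (\<exists>x\<in>K. x + t \<in> K)"
    then have disj: "K \<inter> (+) t ` K = {}"
      by (auto simp: add.commute)
    have "(+) t ` K \<subseteq> U"
    proof
      fix y assume "y \<in> (+) t ` K"
      then obtain x where "x \<in> K" "y = t + x" by blast
      then have "infdist y K \<le> \<eta>"
        using infdist_le[of x K y] t by (simp add: dist_real_def)
      then show "y \<in> U" using \<eta>(2) by blast
    qed
    then have "measure lebesgue (K \<union> (+) t ` K) \<le> measure lebesgue U"
      using U(2) U_meas K by (intro measure_mono_fmeasurable) (auto simp: measurable_translation fmeasurableD)
    moreover have "measure lebesgue (K \<union> (+) t ` K) = 2 * measure lebesgue K"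
      using measure_Un3[OF K measurable_translation[OF K, of t]] disj
      by (simp add: measure_translation)
    ultimately show False
      using small by simp
  qed
  with \<eta>(1) show ?thesis by blast
qed

text \<open>
  The points of \<open>K\<close> at the left end of a gap of length at least
  \<open>\<delta>\<close>. The maximum of \<open>K\<close> is one of them, for every
  \<open>\<delta>\<close>.
\<close>

definition gap_starts :: "real set \<Rightarrow> real \<Rightarrow> real set" where
  "gap_starts K \<delta> = {x \<in> K. \<forall>y. x < y \<and> y < x + \<delta> \<longrightarrow> y \<notin> K}"

lemma gap_starts_antimono: "\<delta> \<le> \<delta>' \<Longrightarrow> gap_starts K \<delta>' \<subseteq> gap_starts K \<delta>"
  by (auto simp: gap_starts_def)

text \<open>
  Distinct points of \<open>gap_starts K \<delta>\<close> are at least \<open>\<delta>\<close>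
  apart, so rounding down to multiples of \<open>\<delta>\<close> separates them.
\<close>

lemma finite_gap_starts:
  assumes "bounded K" "0 < \<delta>"
  shows "finite (gap_starts K \<delta>)"
proof -
  obtain B where B: "\<And>x. x \<in> K \<Longrightarrow> \<bar>x\<bar> \<le> B"
    using assms(1) by (auto simp: bounded_iff)
  have "x = y" if "x \<in> gap_starts K \<delta>" "y \<in> gap_starts K \<delta>" "\<lfloor>x / \<delta>\<rfloor> = \<lfloor>y / \<delta>\<rfloor>" for x y
  proof -
    have "\<bar>x / \<delta> - y / \<delta>\<bar> < 1"
      using that(3) by linarith
    then have "\<bar>x - y\<bar> < \<delta>"
      using assms(2) by (simp add: diff_divide_distrib[symmetric] abs_divide)
    then have "\<not> x < y" "\<not> y < x"
      using that(1,2) unfolding gap_starts_def by auto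
    then show ?thesis by simp
  qed
  then have "inj_on (\<lambda>x. \<lfloor>x / \<delta>\<rfloor>) (gap_starts K \<delta>)"
    by (auto intro: inj_onI)
  moreover have "(\<lambda>x. \<lfloor>x / \<delta>\<rfloor>) ` gap_starts K \<delta> \<subseteq> {\<lfloor>- B / \<delta>\<rfloor>..\<lfloor>B / \<delta>\<rfloor>}"
  proof
    fix k assume "k \<in> (\<lambda>x. \<lfloor>x / \<delta>\<rfloor>) ` gap_starts K \<delta>"
    then obtain x where "x \<in> K" "k = \<lfloor>x / \<delta>\<rfloor>"
      unfolding gap_starts_def by blast
    then have "- B \<le> x" "x \<le> B"
      using B[of x] by auto
    then have "- B / \<delta> \<le> x / \<delta>" "x / \<delta> \<le> B / \<delta>"
      using assms(2) by (intro divide_right_mono; simp)+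
    then show "k \<in> {\<lfloor>- B / \<delta>\<rfloor>..\<lfloor>B / \<delta>\<rfloor>}"
      unfolding \<open>k = _\<close> atLeastAtMost_iff by (intro conjI floor_mono)
  qed
  ultimately show ?thesis
    by (meson finite_atLeastAtMost_int finite_imageD finite_subset)
qed

text \<open>
  Some \<open>z\<close> just above \<open>x\<close> is missing from \<open>K\<close>; the last
  point of \<open>K\<close> before \<open>z\<close> starts a gap.
\<close>

lemma ex_gap_start_near:
  assumes "compact K" "nowhere_dense K" "x \<in> K" "0 < \<eta>"
  shows "\<exists>\<delta>>0. \<exists>y\<in>gap_starts K \<delta>. \<bar>y - x\<bar> < \<eta>"
proof -
  have "closed K"
    using assms(1) by (rule compact_imp_closed)
  have "\<not> {x<..<x + \<eta>} \<subseteq> K"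
  proof
    assume "{x<..<x + \<eta>} \<subseteq> K"
    then have "{x<..<x + \<eta>} \<subseteq> interior K"
      by (intro interior_maximal) auto
    then show False
      using assms(2,4) \<open>closed K\<close> unfolding nowhere_dense_def by simp
  qed
  then obtain z where z: "x < z" "z < x + \<eta>" "z \<notin> K" by (auto simp: subset_iff)
  have "compact (K \<inter> {..z})" "K \<inter> {..z} \<noteq> {}"
    using assms(1,3) z(1) by (auto intro: compact_Int_closed)
  then obtain y where y: "y \<in> K \<inter> {..z}" "\<And>w. w \<in> K \<inter> {..z} \<Longrightarrow> w \<le> y"
    using compact_attains_sup by metis
  have "y < z"
    using y(1) z(3) by (cases "y = z") auto
  moreover have "x \<le> y"
    using y(2)[of x] assms(3) z(1) by simp
  moreover have "y \<in> gap_starts K (z - y)"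
    using y unfolding gap_starts_def by force
  ultimately show ?thesis
    using z(2) by (intro exI[of _ "z - y"] conjI bexI[of _ y]) auto
qed

theorem lemma4p5:
  fixes R :: "(real, 'f, 'r) fo_structure"
    and A :: "real set"
  assumes "expands_ordered_group_real R"
    and "\<not> defines_B R"
    and "definable_subset R A"
    and "nowhere_dense A"
  shows "A \<in> null_sets lebesgue"
proof (rule ccontr)
  assume not_null: "A \<notin> null_sets lebesgue"
  interpret ordered_group_expansion R
    using assms(1) by unfold_locales
  have "\<exists>m::nat. closure A \<inter> {- real m..real m} \<notin> null_sets lebesgue"
  proof (rule ccontr)
    assume "\<not> ?thesis"
    then have "(\<Union>m::nat. closure A \<inter> {- real m..real m}) \<in> null_sets lebesgue"
      by (intro null_sets_UN) auto
    moreover have "A \<subseteq> (\<Union>m::nat. closure A \<inter> {- real m..real m})"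
    proof
      fix x assume "x \<in> A"
      moreover obtain m :: nat where "\<bar>x\<bar> \<le> real m"
        using real_arch_simple by blast
      ultimately show "x \<in> (\<Union>m::nat. closure A \<inter> {- real m..real m})"
        using closure_subset by (intro UN_I[of m]) (auto simp: abs_le_iff)
    qed
    ultimately show False
      using not_null null_sets_completion_subset by blast
  qed
  then obtain m :: nat where m: "closure A \<inter> {- real m..real m} \<notin> null_sets lebesgue" ..
  define K where "K = closure A \<inter> {- real m..real m}"
  have K: "compact K"
    unfolding K_def by (simp add: closed_Int_compact)
  have "nowhere_dense K"
    using assms(4) interior_mono[of K "closure A"] compact_imp_closed[OF K]
    unfolding nowhere_dense_def by (auto simp: K_def closure_closed)
  obtain \<eta> where \<eta>: "0 < \<eta>" "\<And>t. \<bar>t\<bar> < \<eta> \<Longrightarrow> \<exists>x\<in>K. x + t \<in> K"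
    using ex_differences_near_zero[OF K] m unfolding K_def by blast
  define G where "G \<delta> = {z. 0 < z \<and> z < \<eta> \<and>
    (\<exists>x y. x \<in> gap_starts K \<delta> \<and> y \<in> gap_starts K \<delta> \<and> y = x + z)}" for \<delta>
  interpret definable_refinement R G 0 \<eta>
  proof
    show "finite (G \<delta>)" if "0 < \<delta>" for \<delta>
    proof (rule finite_subset)
      show "G \<delta> \<subseteq> (\<lambda>(x, y). y - x) ` (gap_starts K \<delta> \<times> gap_starts K \<delta>)"
        by (force simp: G_def)
      show "finite ((\<lambda>(x, y). y - x) ` (gap_starts K \<delta> \<times> gap_starts K \<delta>))"
        using finite_gap_starts[OF compact_imp_bounded[OF K] that] by blast
    qed
    show "G \<delta>' \<subseteq> G \<delta>" if "\<delta> \<le> \<delta>'" for \<delta> \<delta>'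
      using gap_starts_antimono[OF that, of K] unfolding G_def by blast
    show "\<exists>\<delta>>0. \<exists>z\<in>G \<delta>. x < z \<and> z < y" if xy: "0 \<le> x" "x < y" "y \<le> \<eta>" for x y
    proof -
      \<comment> \<open>The midpoint \<open>t\<close> is a difference of points of \<open>K\<close>; moving both to nearby gap starts changes it by
        less than half the length of \<open>(x, y)\<close>.\<close>
      define t where "t = (x + y) / 2"
      define r where "r = (y - x) / 4"
      have tr: "\<bar>t\<bar> < \<eta>" "0 < r" "x + 2 * r = t" "t + 2 * r = y"
        using xy by (auto simp: t_def r_def field_simps)
      obtain k where k: "k \<in> K" "k + t \<in> K"
        using \<eta>(2)[OF tr(1)] by blast
      obtain \<delta>1 u where u: "0 < \<delta>1" "u \<in> gap_starts K \<delta>1" "\<bar>u - k\<bar> < r"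
        using ex_gap_start_near[OF K \<open>nowhere_dense K\<close> k(1) tr(2)] by blast
      obtain \<delta>2 v where v: "0 < \<delta>2" "v \<in> gap_starts K \<delta>2" "\<bar>v - (k + t)\<bar> < r"
        using ex_gap_start_near[OF K \<open>nowhere_dense K\<close> k(2) tr(2)] by blast
      have "x < v - u" "v - u < y"
        using u(3) v(3) tr(3,4) by linarith+
      moreover have "u \<in> gap_starts K (min \<delta>1 \<delta>2)" "v \<in> gap_starts K (min \<delta>1 \<delta>2)"
        using u(2) v(2) gap_starts_antimono[of "min \<delta>1 \<delta>2" _ K]
        by (meson min.cobounded1 min.cobounded2 subsetD)+
      then have "v - u \<in> G (min \<delta>1 \<delta>2)"
        unfolding G_def using calculation xy by (intro CollectI conjI exI[of _ u] exI[of _ v]) auto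
      ultimately show ?thesis
        using u(1) v(1) by (intro exI[of _ "min \<delta>1 \<delta>2"] conjI bexI[of _ "v - u"]) auto
    qed
    \<comment> \<open>Closures are definable, since intervals form a basis of the topology.\<close>
    have "x \<in> closure A \<longleftrightarrow> (\<forall>u v. u < x \<and> x < v \<longrightarrow> (\<exists>y. u < y \<and> y < v \<and> y \<in> A))" for x
    proof
      assume "x \<in> closure A"
      then show "\<forall>u v. u < x \<and> x < v \<longrightarrow> (\<exists>y. u < y \<and> y < v \<and> y \<in> A)"
        unfolding closure_iff_nhds_not_empty
        by (metis disjoint_iff greaterThanLessThan_iff open_greaterThanLessThan order_refl)
    next
      assume *: "\<forall>u v. u < x \<and> x < v \<longrightarrow> (\<exists>y. u < y \<and> y < v \<and> y \<in> A)"
      show "x \<in> closure A"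
        unfolding closure_approachable
      proof (intro allI impI)
        fix \<epsilon> :: real assume "0 < \<epsilon>"
        then obtain y where "x - \<epsilon> < y" "y < x + \<epsilon>" "y \<in> A"
          using *[rule_format, of "x - \<epsilon>" "x + \<epsilon>"] by auto
        then show "\<exists>y\<in>A. dist y x < \<epsilon>"
          by (intro bexI[of _ y]) (auto simp: dist_real_def abs_less_iff)
      qed
    qed
    then have "definable_pred R (\<lambda>e. e i \<in> K)" for i
      unfolding K_def Int_iff atLeastAtMost_iff
      by (simp only:) (intro definable_intros definable_pred_member[OF assms(3)])
    then have "definable_pred R (\<lambda>e. e i \<in> gap_starts K (e j))" for i j
      unfolding gap_starts_def mem_Collect_eq by (intro definable_intros)
    then show "definable_pred R (\<lambda>e. e i \<in> G (e j))" for i j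
      unfolding G_def mem_Collect_eq by (intro definable_intros)
  qed (use \<eta>(1) in \<open>auto simp: G_def\<close>)
  show False
    using defines_B assms(2) by contradiction
qed

end
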